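(* Let $L:(0,1)\to(0,\infty)$ be an Osgood modulus of continuity, i.e. $\mathcal{M}(z):=\int_z^1\frac{dr}{L(r)}$ is finite for $0<z<1$ and $\lim_{z\to0^+}\mathcal{M}(z)=\infty$. Let $u:\mathbb{R}^d\times[0,\infty)\to\mathbb{R}^d$ be a bounded continuous incompressible velocity field having modulus of continuity $L$: there is a function $C(t)\ge 0$, integrable on $(0,T)$ for every $T<\infty$, such that $$|u(x,t)-u(y,t)|\le C(t)\,L(|x-y|)\qquad\text{for all } t\ge 0 \text{ and all } x,y \text{ with } 0<|x-y|<1 .$$ Let $\phi(\cdot,t)$ be the flow of $u$, let $\theta_0:\mathbb{R}^d\to\mathbb{R}$, and let $\theta(t)$ be the (Lagrangian) weak solution of the transport equation $\partial_t\theta+u\cdot\nabla\theta=0$, $\theta|_{t=0}=\theta_0$. Then for every $\gamma\in\mathbb{R}$ and every $t\ge 0$, $$[\theta(t)]_{\gamma,L}=[\theta_0]_{\gamma,L}.$$ In fact, the localized seminorm is carried by the flow: for every $x\in\mathbb{R}^d$, $$[\theta(t)]_{\phi(x,t),\gamma,L}=[\theta_0]_{x,\gamma,L}.$$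
   Context: The flow $\phi$ is the unique solution of $\frac{d}{dt}\phi(x,t)=u(\phi(x,t),t)$, $\phi(x,0)=x$; for each $t$ the map $\phi(\cdot,t)$ is a homeomorphism of $\mathbb{R}^d$ (uniqueness and invertibility follow from the Osgood condition). For Osgood velocity fields the integrable weak solution of the transport equation is unique and is given by the Lagrangian formula $\theta(x,t)=\theta_0(\phi_t^{-1}(x))$, where $\phi_t=\phi(\cdot,t)$; "the weak solution" means this function, defined pointwise everywhere. For $f:\mathbb{R}^d\to\mathbb{R}$, $\gamma\in\mathbb{R}$, $x\in\mathbb{R}^d$, the seminorms (with values in $[0,\infty]$) are $$[f]_{\gamma,L}=\lim_{r\to0^+}\ \sup_{x,y:\,0<|x-y|<r}\frac{|f(x)-f(y)|}{\mathcal{M}(|x-y|)^\gamma},\qquad [f]_{x,\gamma,L}=\lim_{r\to0^+}\ \sup_{y:\,0<|x-y|<r}\frac{|f(x)-f(y)|}{\mathcal{M}(|x-y|)^\gamma}.$$ *)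

theory Defs
  imports "HOL-Analysis.Analysis"
begin

definition osgood_M :: "(real \<Rightarrow> real) \<Rightarrow> real \<Rightarrow> real" where
  "osgood_M L z = (LINT r:{z<..<1}|lebesgue. 1 / L r)"

text \<open>Only the values of \<open>L\<close> on the open interval from 0 to 1 matter.\<close>

definition osgood_modulus :: "(real \<Rightarrow> real) \<Rightarrow> bool" where
  "osgood_modulus L \<longleftrightarrow>
     (\<forall>r. 0 < r \<and> r < 1 \<longrightarrow> 0 < L r) \<and>
     (\<forall>z. 0 < z \<and> z < 1 \<longrightarrow> (\<lambda>r. 1 / L r) absolutely_integrable_on {z<..<1}) \<and>
     filterlim (osgood_M L) at_top (at_right 0)"

definition has_modulus_of_continuity ::
    "('a::real_normed_vector \<Rightarrow> real \<Rightarrow> 'a) \<Rightarrow> (real \<Rightarrow> real) \<Rightarrow> bool" where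
  "has_modulus_of_continuity u L \<longleftrightarrow>
     (\<exists>C. (\<forall>t\<ge>0. 0 \<le> C t) \<and>
          (\<forall>T>0. C absolutely_integrable_on {0<..<T}) \<and>
          (\<forall>t\<ge>0. \<forall>x y. 0 < norm (x - y) \<and> norm (x - y) < 1 \<longrightarrow>
             norm (u x t - u y t) \<le> C t * L (norm (x - y))))"

text \<open>\<open>C_k k f\<close>: \<open>f\<close> is \<open>k\<close> times continuously differentiable on the whole space;
  the recursion runs over the directional derivatives of \<open>f\<close>.\<close>

primrec C_k :: "nat \<Rightarrow> ('a::euclidean_space \<Rightarrow> real) \<Rightarrow> bool" where
  "C_k 0 f \<longleftrightarrow> continuous_on UNIV f"
| "C_k (Suc k) f \<longleftrightarrow>
     (\<exists>f'. (\<forall>x. (f has_derivative f' x) (at x)) \<and> (\<forall>v. C_k k (\<lambda>x. f' x v)))"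

definition test_function :: "('a::euclidean_space \<Rightarrow> real) \<Rightarrow> bool" where
  "test_function \<psi> \<longleftrightarrow> (\<forall>k. C_k k \<psi>) \<and> compact (closure {x. \<psi> x \<noteq> 0})"

text \<open>Since \<open>u\<close> need not be differentiable, incompressibility means that the distributional
  divergence of each time slice vanishes; the integrand below is
  \<open>u(x, t) \<cdot> \<nabla>\<psi>(x)\<close>.\<close>

definition incompressible :: "('a::euclidean_space \<Rightarrow> real \<Rightarrow> 'a) \<Rightarrow> bool" where
  "incompressible u \<longleftrightarrow>
     (\<forall>t\<ge>0. \<forall>\<psi>. test_function \<psi> \<longrightarrow>
        (LINT x|lborel. frechet_derivative \<psi> (at x) (u x t)) = 0)"

text \<open>Time runs over the nonnegative reals, so the derivative at time 0 is one-sided.\<close>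

definition is_flow ::
    "('a::real_normed_vector \<Rightarrow> real \<Rightarrow> 'a) \<Rightarrow> ('a \<Rightarrow> real \<Rightarrow> 'a) \<Rightarrow> bool" where
  "is_flow u \<phi> \<longleftrightarrow>
     (\<forall>x. \<phi> x 0 = x \<and>
        (\<forall>t\<ge>0. (\<phi> x has_vector_derivative u (\<phi> x t) t) (at t within {0..})))"

definition lagrangian_solution ::
    "('a \<Rightarrow> real \<Rightarrow> 'a) \<Rightarrow> ('a \<Rightarrow> real) \<Rightarrow> real \<Rightarrow> 'a \<Rightarrow> real" where
  "lagrangian_solution \<phi> \<theta>0 t x = \<theta>0 (inv (\<lambda>y. \<phi> y t) x)"

text \<open>In both seminorms the radii \<open>r > 1\<close>, for which \<open>osgood_M L\<close> is evaluated outside its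
  natural domain, do not affect the limit.\<close>

definition seminorm_L ::
    "(real \<Rightarrow> real) \<Rightarrow> real \<Rightarrow> ('a::real_normed_vector \<Rightarrow> real) \<Rightarrow> ennreal" where
  "seminorm_L L \<gamma> f =
     Lim (at_right 0) (\<lambda>r. SUP (x, y)\<in>{(x, y). 0 < norm (x - y) \<and> norm (x - y) < r}.
       ennreal (\<bar>f x - f y\<bar> / osgood_M L (norm (x - y)) powr \<gamma>))"

definition local_seminorm_L ::
    "(real \<Rightarrow> real) \<Rightarrow> real \<Rightarrow> 'a::real_normed_vector \<Rightarrow> ('a \<Rightarrow> real) \<Rightarrow> ennreal" where
  "local_seminorm_L L \<gamma> x f =
     Lim (at_right 0) (\<lambda>r. SUP y\<in>{y. 0 < norm (x - y) \<and> norm (x - y) < r}.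
       ennreal (\<bar>f x - f y\<bar> / osgood_M L (norm (x - y)) powr \<gamma>))"

text \<open>The limits always exist, because the suprema are monotone in the radius.\<close>

lemma mono_tendsto_Lim_at_right:
  fixes g :: "real \<Rightarrow> ennreal"
  assumes "mono g"
  shows "(g \<longlongrightarrow> Lim (at_right a) g) (at_right a)"
proof -
  have "(g \<longlongrightarrow> Inf (g ` ({a<..} \<inter> UNIV))) (at a within ({a<..} \<inter> UNIV))"
    by (rule Lim_right_bound[where K = 0]) (use assms in \<open>auto dest: monoD\<close>)
  then have lim: "(g \<longlongrightarrow> Inf (g ` {a<..})) (at_right a)"
    by simp
  moreover have "Lim (at_right a) g = Inf (g ` {a<..})"
    by (rule tendsto_Lim[OF _ lim]) simp
  ultimately show ?thesis
    by simp
qed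

lemma seminorm_L_tendsto:
  "((\<lambda>r. SUP (x, y)\<in>{(x, y). 0 < norm (x - y) \<and> norm (x - y) < r}.
       ennreal (\<bar>f x - f y\<bar> / osgood_M L (norm (x - y)) powr \<gamma>)) \<longlongrightarrow> seminorm_L L \<gamma> f)
     (at_right 0)"
  unfolding seminorm_L_def
  by (rule mono_tendsto_Lim_at_right, rule monoI, rule SUP_subset_mono) auto

lemma local_seminorm_L_tendsto:
  "((\<lambda>r. SUP y\<in>{y. 0 < norm (x - y) \<and> norm (x - y) < r}.
       ennreal (\<bar>f x - f y\<bar> / osgood_M L (norm (x - y)) powr \<gamma>)) \<longlongrightarrow> local_seminorm_L L \<gamma> x f)
     (at_right 0)"
  unfolding local_seminorm_L_def
  by (rule mono_tendsto_Lim_at_right, rule monoI, rule SUP_subset_mono) auto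

end

theory Submission
  imports Defs
begin

text \<open>Why the seminorms are carried by the flow: along two trajectories the distance
  \<open>z(s) = |\<phi>(x, s) - \<phi>(y, s)|\<close> satisfies \<open>|z'| \<le> C L(z)\<close> as long as \<open>0 < z < 1\<close>. With
  \<open>\<M> = osgood_M L\<close>, formally \<open>\<M>' = -1/L\<close>, this says that \<open>\<M>(z)\<close> moves at speed at most \<open>C\<close>, and therefore
  \<open>|\<M>(|\<phi>(x, t) - \<phi>(y, t)|) - \<M>(|x - y|)| \<le> \<integral>\<^sub>0\<^sup>t C\<close>
  (lemma \<open>flow_M_bound\<close>). Since \<open>osgood_M L\<close> vanishes on \<open>[1, \<infinity>)\<close>, the bound holds
  for all pairs of distinct points, however far apart.

  The function \<open>\<M>\<close> is unbounded at 0, so an additive bound on its distortion is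
  multiplicatively negligible at small distances: the quotient
  \<open>\<M>(|\<phi>(x, t) - \<phi>(y, t)|)\<^sup>\<gamma> / \<M>(|x - y|)\<^sup>\<gamma>\<close> tends to 1 uniformly as
  \<open>|x - y| \<rightarrow> 0\<close>. Hence composition with \<open>\<phi>\<^sub>t\<close> does not increase the seminorms. The
  distortion bound is symmetric in source and target, so it passes to the inverse map, and
  composition with \<open>\<phi>\<^sub>t\<^sup>-\<^sup>1\<close> does not increase them either (lemma \<open>pair_seminorm_comp_eq\<close>).

  The same bound makes the flow a homeomorphism. Trajectories cannot meet, because \<open>\<M>(z)\<close>
  would have to become infinite in finite time (lemma \<open>flow_separates\<close>); and \<open>\<phi>\<^sub>t\<close> is
  uniformly continuous, because large \<open>\<M>\<close> means small distance. It is onto because a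
  continuous map that moves points by a bounded amount is onto, by Brouwer's theorem
  (lemma \<open>bounded_displacement_surj\<close>); this avoids solving the equation backwards in time.\<close>

section \<open>The function \<open>\<M>\<close> along differentiable paths\<close>

text \<open>The one-dimensional case of \<open>integral_on_image_ubound_nonneg\<close>, transported along the
  identification of the reals with \<open>real ^ 1\<close>. Here \<open>g\<close> may go back and forth, which
  distances between trajectories do.\<close>

lemma integral_image_ubound_real:
  fixes f g g' :: "real \<Rightarrow> real"
  assumes nonneg: "\<And>x. x \<in> S \<Longrightarrow> 0 \<le> f (g x)"
    and der: "\<And>x. x \<in> S \<Longrightarrow> (g has_real_derivative g' x) (at x within S)"
    and int: "(\<lambda>x. \<bar>g' x\<bar> * f (g x)) integrable_on S"
  shows "f integrable_on (g ` S)"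
    and "integral (g ` S) f \<le> integral S (\<lambda>x. \<bar>g' x\<bar> * f (g x))"
proof -
  let ?lift = "vec :: real \<Rightarrow> real^1" and ?drop = "\<lambda>x::real^1. x $ 1"
  have "((\<lambda>x. vec (g (x $ 1))) has_derivative (*\<^sub>R) (g' z)) (at (vec z) within ?lift ` S)"
    if "z \<in> S" for z
    using der[OF that]
    by (simp add: has_real_derivative_iff_has_vector_derivative has_vector_derivative_def
        has_derivative_vector_1)
  then have der': "(?lift \<circ> g \<circ> ?drop has_derivative (*\<^sub>R) (g' (?drop x))) (at x within ?lift ` S)"
    if "x \<in> ?lift ` S" for x
    using that by (auto simp: o_def)
  have eq: "(\<lambda>x. \<bar>det (matrix ((*\<^sub>R) (g' (?drop x)) :: real^1 \<Rightarrow> real^1))\<bar>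
               * (f \<circ> ?drop) ((?lift \<circ> g \<circ> ?drop) x)) = (\<lambda>x. \<bar>g' x\<bar> * f (g x)) \<circ> ?drop"
    by (auto simp: o_def)
  have drop: "(h \<circ> ?drop) integrable_on ?lift ` A \<longleftrightarrow> h integrable_on A" for h :: "real \<Rightarrow> real" and A
  proof -
    have im: "?drop ` ?lift ` A = A" and h: "(h \<circ> ?drop) \<circ> vec = h"
      by (simp_all add: image_comp o_def)
    have "(h \<circ> ?drop has_integral i) (?lift ` A) \<longleftrightarrow> (h has_integral i) A" for i
      using has_integral_vec1_I[of "h \<circ> ?drop" i "?lift ` A"]
        has_integral_vec1_D[of "h \<circ> ?drop" i "?lift ` A"] unfolding im h by blast
    then show ?thesis by (simp add: integrable_on_def)
  qed
  have "(\<lambda>x. \<bar>g' x\<bar> * f (g x)) \<circ> ?drop integrable_on ?lift ` S"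
    using int by (simp add: drop)
  note * = integral_on_image_ubound_nonneg[where f = "f \<circ> ?drop", OF _ der', unfolded eq, OF _ _ this]
  have im: "(?lift \<circ> g \<circ> ?drop) ` ?lift ` S = ?lift ` g ` S"
    by (auto simp: image_comp o_def)
  have nonneg': "0 \<le> (f \<circ> ?drop) ((?lift \<circ> g \<circ> ?drop) x)" if "x \<in> ?lift ` S" for x
    using that nonneg by auto
  have A: "(f \<circ> ?drop) integrable_on ?lift ` g ` S \<and> integral (?lift ` g ` S) (f \<circ> ?drop)
      \<le> integral (?lift ` S) ((\<lambda>x. \<bar>g' x\<bar> * f (g x)) \<circ> ?drop)"
    using *[OF nonneg'] unfolding im .
  show "f integrable_on (g ` S)"
    using A by (simp add: drop)
  show "integral (g ` S) f \<le> integral S (\<lambda>x. \<bar>g' x\<bar> * f (g x))"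
    using A by (simp add: integral_vec1_eq o_def image_comp)
qed

text \<open>The modulus \<open>L\<close> is only measurable in the Lebesgue sense, and such functions are not
  stable under composition with a continuous path. A Borel function below \<open>1/L\<close> that agrees
  with it almost everywhere is: it has the same integrals, while the pointwise inequality
  \<open>f \<le> 1/L\<close> keeps the velocity estimate valid at every single time.\<close>

lemma osgood_density:
  assumes "osgood_modulus L"
  obtains f where "f \<in> borel_measurable borel" "\<And>r. 0 \<le> f r"
    "\<And>r. 0 < r \<Longrightarrow> r < 1 \<Longrightarrow> f r * L r \<le> 1" "\<And>r. 1 \<le> r \<Longrightarrow> f r = 0"
    "\<And>a b. 0 < a \<Longrightarrow> a \<le> b \<Longrightarrow> (f has_integral (osgood_M L a - osgood_M L b)) {a..b}"
proof -
  have pos: "\<And>r. 0 < r \<Longrightarrow> r < 1 \<Longrightarrow> 0 < L r"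
    and int: "\<And>z. 0 < z \<Longrightarrow> z < 1 \<Longrightarrow> (\<lambda>r. 1 / L r) absolutely_integrable_on {z<..<1}"
    using assms by (auto simp: osgood_modulus_def)
  define g where "g r = (if 0 < r \<and> r < 1 then 1 / L r else 0)" for r
  have tail: "(g has_integral osgood_M L a) {a..}" if "0 < a" for a
  proof (cases "a < 1")
    case True
    have "((\<lambda>r. 1 / L r) has_integral osgood_M L a) {a<..<1}"
      using int[OF that True] unfolding osgood_M_def
      by (simp add: has_integral_integral[symmetric] set_lebesgue_integral_eq_integral)
    then have "(g has_integral osgood_M L a) {a<..<1}"
      by (rule has_integral_eq[rotated]) (use that in \<open>auto simp: g_def\<close>)
    then have "(g has_integral osgood_M L a) {a..1}"
      by (simp add: has_integral_Icc_iff_Ioo)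
    moreover have "(g has_integral 0) {1..}"
      by (rule has_integral_is_0) (auto simp: g_def)
    ultimately have "(g has_integral (osgood_M L a + 0)) ({a..1} \<union> {1..})"
      by (rule has_integral_Un) (use True in \<open>auto intro: negligible_subset[OF negligible_sing[of 1]]\<close>)
    moreover have "{a..1} \<union> {1..} = {a..}" using True by auto
    ultimately show ?thesis by simp
  next
    case False
    then have "osgood_M L a = 0"
      by (simp add: osgood_M_def set_lebesgue_integral_def)
    moreover have "(g has_integral 0) {a..}"
      by (rule has_integral_is_0) (use False in \<open>auto simp: g_def\<close>)
    ultimately show ?thesis by simp
  qed
  have g_int: "(g has_integral (osgood_M L a - osgood_M L b)) {a..b}" if "0 < a" "a \<le> b" for a b
  proof -
    have "g integrable_on {a..b}"
      using tail[OF that(1)] integrable_on_subinterval[of g "{a..}" a b] by auto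
    then obtain i where i: "(g has_integral i) {a..b}"
      by (auto simp: integrable_on_def)
    have "(g has_integral (i + osgood_M L b)) ({a..b} \<union> {b..})"
      by (rule has_integral_Un[OF i tail])
        (use that in \<open>auto intro: negligible_subset[OF negligible_sing[of b]]\<close>)
    moreover have "{a..b} \<union> {b..} = {a..}" using that by auto
    ultimately have "i + osgood_M L b = osgood_M L a"
      using has_integral_unique tail[OF that(1)] by metis
    then have "i = osgood_M L a - osgood_M L b" by simp
    then show ?thesis using i by simp
  qed
  \<comment> \<open>\<open>1/L\<close> need not be integrable up to 0, so measurability on \<open>(0,1)\<close> comes from exhaustion.\<close>
  have "g \<in> borel_measurable lebesgue"
  proof (rule borel_measurable_LIMSEQ_real)
    define h where "h n r = indicator {1 / real (Suc (Suc n))<..<1} r *\<^sub>R (1 / L r)" for n r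
    show "h n \<in> borel_measurable lebesgue" for n
      using int[of "1 / real (Suc (Suc n))"]
      unfolding h_def set_integrable_def by (auto dest: borel_measurable_integrable)
    show "(\<lambda>n. h n r) \<longlonglongrightarrow> g r" if "r \<in> space lebesgue" for r
    proof (cases "0 < r \<and> r < 1")
      case True
      have "(\<lambda>n. 1 / real (Suc n)) \<longlonglongrightarrow> 0"
        using LIMSEQ_inverse_real_of_nat by (simp add: inverse_eq_divide)
      then have "(\<lambda>n. 1 / real (Suc (Suc n))) \<longlonglongrightarrow> 0"
        by (rule LIMSEQ_Suc)
      then have "eventually (\<lambda>n. 1 / real (Suc (Suc n)) < r) sequentially"
        using True by (auto dest: order_tendstoD(2))
      then have "eventually (\<lambda>n. h n r = g r) sequentially"
        by eventually_elim (use True in \<open>auto simp: h_def g_def\<close>)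
      then show ?thesis by (rule tendsto_eventually)
    next
      case False
      have "h n r = g r" for n
      proof -
        have "0 < 1 / real (Suc (Suc n))" by simp
        then have "r \<notin> {1 / real (Suc (Suc n))<..<1}"
          using False by (meson greaterThanLessThan_iff less_trans)
        then show ?thesis
          using False unfolding h_def g_def by auto
      qed
      then show ?thesis by simp
    qed
  qed
  then obtain g' where g': "g' \<in> borel_measurable lborel" "AE x in lborel. g x = g' x"
    using completion_ex_borel_measurable_real by blast
  then obtain N where N: "N \<in> null_sets lborel" "{x \<in> space lborel. g x \<noteq> g' x} \<subseteq> N"
    by (auto simp: eventually_ae_filter)
  then have eqN: "g x = g' x" if "x \<notin> N" for x using that by auto
  \<comment> \<open>Setting \<open>f\<close> to 0 on the exceptional null set keeps it below \<open>g\<close> everywhere.\<close>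
  define f where "f r = indicator (- N) r * g' r" for r
  have N': "N \<in> sets borel" using N by auto
  have f1: "f \<in> borel_measurable borel"
    using g'(1) N' unfolding f_def by simp
  have g0: "0 \<le> g r" for r
    using pos[of r] by (auto simp: g_def less_imp_le)
  have fg: "0 \<le> f r" "f r \<le> g r" for r
    using g0[of r] eqN[of r] by (auto simp: f_def indicator_def)
  show ?thesis
  proof (rule that[OF f1 fg(1)])
    show "f r * L r \<le> 1" if "0 < r" "r < 1" for r
      using fg(2)[of r] pos[OF that] that by (simp add: g_def field_simps)
    show "f r = 0" if "1 \<le> r" for r
      using fg[of r] that by (simp add: g_def)
    show "(f has_integral (osgood_M L a - osgood_M L b)) {a..b}" if "0 < a" "a \<le> b" for a b
      by (rule has_integral_spike[OF _ _ g_int[OF that], of N])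
        (use N eqN in \<open>auto simp: f_def negligible_iff_null_sets null_sets_completionI\<close>)
  qed
qed

lemma osgood_M_antimono:
  assumes "osgood_modulus L" "0 < a" "a \<le> b"
  shows "osgood_M L b \<le> osgood_M L a"
proof -
  obtain f where "\<And>r. 0 \<le> f r" "(f has_integral (osgood_M L a - osgood_M L b)) {a..b}"
    using osgood_density[OF assms(1)] assms(2,3) by metis
  from has_integral_nonneg[OF this(2)] this(1) show ?thesis by simp
qed

text \<open>If \<open>f\<close> is the density of \<open>\<M>\<close>, the difference of \<open>\<M>\<close> at the endpoints is the integral
  of \<open>f\<close> between \<open>z a\<close> and \<open>z b\<close>. The path covers that interval, so the integral is at most
  \<open>\<integral> |z'| f(z)\<close>, whose integrand is dominated by \<open>C\<close> where \<open>z < 1\<close> and is zero elsewhere.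
  The chain rule for \<open>\<M> \<circ> z\<close> is not available, because \<open>L\<close> may be discontinuous.\<close>

lemma osgood_M_path_bound:
  fixes z z' C :: "real \<Rightarrow> real"
  assumes L: "osgood_modulus L" and "a \<le> b"
    and der: "\<And>s. s \<in> {a..b} \<Longrightarrow> (z has_real_derivative z' s) (at s within {a..b})"
    and cont: "continuous_on {a..b} z'"
    and pos: "\<And>s. s \<in> {a..b} \<Longrightarrow> 0 < z s"
    and C: "C integrable_on {a..b}" "\<And>s. s \<in> {a..b} \<Longrightarrow> 0 \<le> C s"
    and bound: "\<And>s. s \<in> {a..b} \<Longrightarrow> z s < 1 \<Longrightarrow> \<bar>z' s\<bar> \<le> C s * L (z s)"
  shows "\<bar>osgood_M L (z a) - osgood_M L (z b)\<bar> \<le> integral {a..b} C"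
proof -
  obtain f where f: "f \<in> borel_measurable borel" "\<And>r. 0 \<le> f r"
    "\<And>r. 0 < r \<Longrightarrow> r < 1 \<Longrightarrow> f r * L r \<le> 1" "\<And>r. 1 \<le> r \<Longrightarrow> f r = 0"
    "\<And>a b. 0 < a \<Longrightarrow> a \<le> b \<Longrightarrow> (f has_integral (osgood_M L a - osgood_M L b)) {a..b}"
    using osgood_density[OF L] by blast
  have contz: "continuous_on {a..b} z"
    using der by (rule DERIV_continuous_on)
  have dom: "\<bar>z' s\<bar> * f (z s) \<le> C s" if s: "s \<in> {a..b}" for s
  proof (cases "z s < 1")
    case True
    have "\<bar>z' s\<bar> * f (z s) \<le> C s * L (z s) * f (z s)"
      by (rule mult_right_mono[OF bound[OF s True] f(2)])
    also have "\<dots> = C s * (f (z s) * L (z s))" by simp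
    also have "\<dots> \<le> C s"
      using mult_left_mono[OF f(3)[OF pos[OF s] True] C(2)[OF s]] by simp
    finally show ?thesis .
  next
    case False
    then show ?thesis using f(4)[of "z s"] C(2)[OF s] by simp
  qed
  have meas: "(\<lambda>s. \<bar>z' s\<bar> * f (z s)) \<in> borel_measurable (lebesgue_on {a..b})"
  proof -
    have "z \<in> borel_measurable (lebesgue_on {a..b})" "z' \<in> borel_measurable (lebesgue_on {a..b})"
      using contz cont by (auto intro!: continuous_imp_measurable_on_sets_lebesgue)
    then show ?thesis using f(1) by measurable
  qed
  have int: "(\<lambda>s. \<bar>z' s\<bar> * f (z s)) integrable_on {a..b}"
    by (rule measurable_bounded_by_integrable_imp_integrable[OF meas C(1)])
      (use dom f(2) in \<open>auto simp: abs_mult\<close>)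
  note im = integral_image_ubound_real[of "{a..b}" f z z', OF f(2) der int]
  let ?p = "min (z a) (z b)" and ?q = "max (z a) (z b)"
  have p: "0 < ?p" "?p \<le> ?q" using pos[of a] pos[of b] \<open>a \<le> b\<close> by auto
  have sub: "{?p..?q} \<subseteq> z ` {a..b}"
  proof -
    have "connected (z ` {a..b})" by (rule connected_continuous_image[OF contz]) simp
    moreover have "?p \<in> z ` {a..b}" "?q \<in> z ` {a..b}"
      using \<open>a \<le> b\<close> by (auto simp: min_def max_def)
    ultimately show ?thesis
      using connected_contains_Icc by blast
  qed
  have "\<bar>osgood_M L (z a) - osgood_M L (z b)\<bar> = \<bar>osgood_M L ?p - osgood_M L ?q\<bar>"
    by (auto simp: min_def max_def)
  also have "\<dots> = integral {?p..?q} f"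
    using f(5)[OF p] osgood_M_antimono[OF L p] by (simp add: integral_unique)
  also have "\<dots> \<le> integral (z ` {a..b}) f"
    by (rule integral_subset_le[OF sub has_integral_integrable[OF f(5)[OF p]] im(1)]) (simp_all add: f(2))
  also have "\<dots> \<le> integral {a..b} (\<lambda>s. \<bar>z' s\<bar> * f (z s))"
    by (rule im(2))
  also have "\<dots> \<le> integral {a..b} C"
    by (rule integral_le[OF int C(1) dom])
  finally show ?thesis .
qed

section \<open>Maps that distort \<open>\<M>\<close> of the distance by a bounded amount\<close>

text \<open>An additive bound on the change of \<open>\<M>(|x - y|)\<close>, for points at any distance from each
  other. For \<open>L r = r\<close>, where \<open>\<M> z = -ln z\<close> on \<open>(0,1)\<close>, this is the bi-Lipschitz
  condition at small distances.\<close>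

definition M_bounded_distortion :: "(real \<Rightarrow> real) \<Rightarrow> ('a::real_normed_vector \<Rightarrow> 'a) \<Rightarrow> bool" where
  "M_bounded_distortion L h \<longleftrightarrow> inj h \<and>
     (\<exists>B. \<forall>x y. x \<noteq> y \<longrightarrow>
        \<bar>osgood_M L (norm (h x - h y)) - osgood_M L (norm (x - y))\<bar> \<le> B)"

lemma M_bounded_distortion_inv:
  assumes "M_bounded_distortion L h" "surj h"
  shows "M_bounded_distortion L (inv h)"
proof -
  from assms obtain B where inj: "inj h" and
    B: "\<And>x y. x \<noteq> y \<Longrightarrow> \<bar>osgood_M L (norm (h x - h y)) - osgood_M L (norm (x - y))\<bar> \<le> B"
    unfolding M_bounded_distortion_def by blast
  have "\<bar>osgood_M L (norm (inv h x - inv h y)) - osgood_M L (norm (x - y))\<bar> \<le> B" if "x \<noteq> y" for x y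
    using B[of "inv h x" "inv h y"] that assms(2)
    by (metis abs_minus_commute surj_f_inv_f)
  then show ?thesis
    using surj_imp_inj_inv[OF assms(2)] unfolding M_bounded_distortion_def by blast
qed

text \<open>A small \<open>|x - y|\<close> makes \<open>\<M>(|x - y|)\<close> exceed \<open>\<M> r + B\<close>; then \<open>\<M>(|h x - h y|)\<close> still
  exceeds \<open>\<M> r\<close>, and \<open>\<M>\<close> is decreasing.\<close>

lemma M_bounded_distortion_uniform:
  assumes L: "osgood_modulus L" and h: "M_bounded_distortion L h" and "0 < r"
  obtains d where "0 < d" "\<And>x y. norm (x - y) < d \<Longrightarrow> norm (h x - h y) < r"
proof -
  from h obtain B where inj: "inj h" and
    B: "\<And>x y. x \<noteq> y \<Longrightarrow> \<bar>osgood_M L (norm (h x - h y)) - osgood_M L (norm (x - y))\<bar> \<le> B"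
    unfolding M_bounded_distortion_def by blast
  have "filterlim (osgood_M L) at_top (at_right 0)"
    using L by (simp add: osgood_modulus_def)
  then have "eventually (\<lambda>z. osgood_M L r + B < osgood_M L z) (at_right 0)"
    by (simp add: filterlim_at_top_dense)
  then obtain d where d: "0 < d" "\<And>z. 0 < z \<Longrightarrow> z < d \<Longrightarrow> osgood_M L r + B < osgood_M L z"
    by (auto simp: eventually_at_right_field)
  have "norm (h x - h y) < r" if "norm (x - y) < d" for x y
  proof (cases "x = y")
    case True
    then show ?thesis using \<open>0 < r\<close> by simp
  next
    case False
    have "osgood_M L r < osgood_M L (norm (h x - h y))"
      using d(2)[of "norm (x - y)"] B[OF False] False that by auto
    then show ?thesis
      using osgood_M_antimono[OF L \<open>0 < r\<close>, of "norm (h x - h y)"] by linarith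
  qed
  then show ?thesis using that d(1) by blast
qed

lemma M_bounded_distortion_continuous:
  assumes "osgood_modulus L" "M_bounded_distortion L h"
  shows "continuous_on UNIV h"
  unfolding continuous_on_iff
  using M_bounded_distortion_uniform[OF assms] by (metis dist_norm)

section \<open>Maps with bounded displacement\<close>

text \<open>A preimage of \<open>y\<close> is a fixed point of \<open>x \<mapsto> y - (h x - x)\<close>, which maps the whole space
  into the ball of radius \<open>K\<close> around \<open>y\<close>.\<close>

lemma bounded_displacement_surj:
  fixes h :: "'a::euclidean_space \<Rightarrow> 'a"
  assumes cont: "continuous_on UNIV h" and disp: "\<And>x. norm (h x - x) \<le> K"
  shows "surj h"
  unfolding surj_def
proof
  fix y
  have "0 \<le> K" using disp[of 0] norm_ge_zero order_trans by blast
  \<comment> \<open>The radius is enlarged by 1 because the ball must be nondegenerate.\<close>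
  have "continuous_on (cball y (K + 1)) (\<lambda>x. y - (h x - x))"
    by (intro continuous_intros continuous_on_subset[OF cont]) auto
  moreover have "(\<lambda>x. y - (h x - x)) \<in> cball y (K + 1) \<rightarrow> cball y (K + 1)"
  proof
    fix x
    show "y - (h x - x) \<in> cball y (K + 1)"
      using disp[of x] by (simp add: dist_norm)
  qed
  ultimately obtain x where "y - (h x - x) = x"
    using brouwer_ball[of "K + 1" y "\<lambda>x. y - (h x - x)"] \<open>0 \<le> K\<close> by auto
  then show "\<exists>x. y = h x" by (auto simp: algebra_simps)
qed

section \<open>The flow of an Osgood velocity field\<close>

lemma flow_vector_derivative:
  assumes "is_flow u \<phi>" "s \<in> {0..t}"
  shows "(\<phi> x has_vector_derivative u (\<phi> x s) s) (at s within {0..t})"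
proof (rule has_vector_derivative_within_subset)
  show "(\<phi> x has_vector_derivative u (\<phi> x s) s) (at s within {0..})"
    using assms by (auto simp: is_flow_def)
qed auto

lemma flow_continuous:
  assumes "is_flow u \<phi>"
  shows "continuous_on {0..t} (\<phi> x)"
  using has_vector_derivative_continuous[OF flow_vector_derivative[OF assms]]
  by (auto simp: continuous_on_eq_continuous_within)

lemma flow_velocity_continuous:
  assumes "is_flow u \<phi>" "continuous_on (UNIV \<times> {0..}) (\<lambda>(x, t). u x t)"
  shows "continuous_on {0..t} (\<lambda>s. u (\<phi> x s) s)"
proof -
  have "continuous_on {0..t} ((\<lambda>(x, t). u x t) \<circ> (\<lambda>s. (\<phi> x s, s)))"
    by (intro continuous_on_compose continuous_intros flow_continuous[OF assms(1)]
        continuous_on_subset[OF assms(2)]) auto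
  then show ?thesis by (simp add: o_def)
qed

lemma flow_displacement:
  fixes u :: "'a::euclidean_space \<Rightarrow> real \<Rightarrow> 'a"
  assumes flow: "is_flow u \<phi>" and u: "\<And>x t. 0 \<le> t \<Longrightarrow> norm (u x t) \<le> K" and "0 \<le> t"
  shows "norm (\<phi> x t - x) \<le> K * t"
proof -
  have "((\<lambda>s. u (\<phi> x s) s) has_integral (\<phi> x t - \<phi> x 0)) {0..t}"
    by (rule fundamental_theorem_of_calculus[OF \<open>0 \<le> t\<close> flow_vector_derivative[OF flow]])
  moreover have "0 \<le> K" using u[of 0 undefined] norm_ge_zero order_trans by blast
  ultimately have "norm (\<phi> x t - \<phi> x 0) \<le> K * measure lborel (cbox 0 t)"
    using u by (intro has_integral_bound[of K "\<lambda>s. u (\<phi> x s) s"]) auto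
  then show ?thesis using flow \<open>0 \<le> t\<close> by (simp add: is_flow_def)
qed

lemma has_real_derivative_norm:
  fixes w :: "real \<Rightarrow> 'a::real_inner"
  assumes "(w has_vector_derivative w') (at s within S)" "w s \<noteq> 0"
  shows "((\<lambda>s. norm (w s)) has_real_derivative (w' \<bullet> sgn (w s))) (at s within S)"
proof -
  have "((\<lambda>s. norm (w s)) has_derivative (\<lambda>h. (h *\<^sub>R w') \<bullet> sgn (w s))) (at s within S)"
    by (rule has_derivative_compose[OF assms(1)[unfolded has_vector_derivative_def]
          has_derivative_norm[OF assms(2)]])
  then show ?thesis
    by (simp add: has_field_derivative_def mult_commute_abs)
qed

text \<open>As long as the trajectories stay apart, their distance is differentiable, and by the
  Cauchy-Schwarz inequality its derivative is at most the difference of the velocities.\<close>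

lemma flow_M_bound:
  fixes u :: "'a::euclidean_space \<Rightarrow> real \<Rightarrow> 'a"
  assumes L: "osgood_modulus L" and flow: "is_flow u \<phi>"
    and cont: "continuous_on (UNIV \<times> {0..}) (\<lambda>(x, t). u x t)"
    and C: "\<And>t. 0 \<le> t \<Longrightarrow> 0 \<le> C t" "C integrable_on {0..t}"
      "\<And>t x y. 0 \<le> t \<Longrightarrow> 0 < norm (x - y) \<Longrightarrow> norm (x - y) < 1 \<Longrightarrow>
         norm (u x t - u y t) \<le> C t * L (norm (x - y))"
    and "0 \<le> t" and ne: "\<And>s. s \<in> {0..t} \<Longrightarrow> \<phi> x s \<noteq> \<phi> y s"
  shows "\<bar>osgood_M L (norm (\<phi> x t - \<phi> y t)) - osgood_M L (norm (x - y))\<bar> \<le> integral {0..t} C"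
proof -
  let ?w = "\<lambda>s. \<phi> x s - \<phi> y s"
  let ?w' = "\<lambda>s. u (\<phi> x s) s - u (\<phi> y s) s"
  have "\<bar>osgood_M L (norm (?w 0)) - osgood_M L (norm (?w t))\<bar> \<le> integral {0..t} C"
  proof (rule osgood_M_path_bound[OF L \<open>0 \<le> t\<close>, where z = "\<lambda>s. norm (?w s)" and z' = "\<lambda>s. ?w' s \<bullet> sgn (?w s)"])
    show "((\<lambda>s. norm (?w s)) has_real_derivative ?w' s \<bullet> sgn (?w s)) (at s within {0..t})"
      if "s \<in> {0..t}" for s
      using that ne[OF that]
      by (intro has_real_derivative_norm has_vector_derivative_diff flow_vector_derivative[OF flow]) auto
    show "continuous_on {0..t} (\<lambda>s. ?w' s \<bullet> sgn (?w s))"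
      using ne by (intro continuous_intros flow_velocity_continuous[OF flow cont] flow_continuous[OF flow]) auto
    show "\<bar>?w' s \<bullet> sgn (?w s)\<bar> \<le> C s * L (norm (?w s))" if "s \<in> {0..t}" "norm (?w s) < 1" for s
    proof -
      have "\<bar>?w' s \<bullet> sgn (?w s)\<bar> \<le> norm (?w' s) * norm (sgn (?w s))"
        by (rule Cauchy_Schwarz_ineq2)
      also have "\<dots> = norm (?w' s)" using ne[OF that(1)] by (simp add: norm_sgn)
      also have "\<dots> \<le> C s * L (norm (?w s))"
        using that ne[OF that(1)] by (intro C(3)) auto
      finally show ?thesis .
    qed
  qed (use C ne in auto)
  then show ?thesis using flow by (simp add: is_flow_def abs_minus_commute)
qed

text \<open>At the first meeting time \<open>T\<close>, \<open>\<M>\<close> of the distance would tend to infinity, whereas before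
  \<open>T\<close> it stays below its initial value plus \<open>\<integral> C\<close>.\<close>

lemma flow_separates:
  fixes u :: "'a::euclidean_space \<Rightarrow> real \<Rightarrow> 'a"
  assumes L: "osgood_modulus L" and flow: "is_flow u \<phi>"
    and cont: "continuous_on (UNIV \<times> {0..}) (\<lambda>(x, t). u x t)"
    and C: "\<And>t. 0 \<le> t \<Longrightarrow> 0 \<le> C t" "\<And>t. C integrable_on {0..t}"
      "\<And>t x y. 0 \<le> t \<Longrightarrow> 0 < norm (x - y) \<Longrightarrow> norm (x - y) < 1 \<Longrightarrow>
         norm (u x t - u y t) \<le> C t * L (norm (x - y))"
    and "0 \<le> t" and "x \<noteq> y"
  shows "\<phi> x t \<noteq> \<phi> y t"
proof
  assume eq: "\<phi> x t = \<phi> y t"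
  let ?w = "\<lambda>s. \<phi> x s - \<phi> y s"
  have contw: "continuous_on {0..t} ?w"
    by (intro continuous_intros flow_continuous[OF flow])
  have w0: "?w 0 = x - y" using flow by (simp add: is_flow_def)
  let ?Z = "{0..t} \<inter> ?w -` {0}"
  have "closed ?Z"
    by (rule continuous_closed_preimage[OF contw]) auto
  then have "compact ?Z" by (auto intro: closed_Int_compact simp: compact_eq_bounded_closed bounded_Int)
  moreover have "t \<in> ?Z" using eq \<open>0 \<le> t\<close> by auto
  ultimately obtain T where T: "T \<in> ?Z" "\<And>s. s \<in> ?Z \<Longrightarrow> T \<le> s"
    using compact_attains_inf[of ?Z] by blast
  have "T \<noteq> 0" using T(1) w0 \<open>x \<noteq> y\<close> by (intro notI) simp
  then have "0 < T" "T \<le> t" using T(1) by auto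
  have ne: "\<phi> x s \<noteq> \<phi> y s" if "0 \<le> s" "s < T" for s
    using T(2)[of s] that \<open>T \<le> t\<close> by force
  define K where "K = osgood_M L (norm (x - y)) + integral {0..t} C"
  have le: "osgood_M L (norm (?w s)) \<le> K" if "0 < s" "s < T" for s
  proof -
    have "\<bar>osgood_M L (norm (?w s)) - osgood_M L (norm (x - y))\<bar> \<le> integral {0..s} C"
      by (rule flow_M_bound[OF L flow cont C(1,2,3)]) (use that ne in auto)
    moreover have "integral {0..s} C \<le> integral {0..t} C"
      by (rule integral_subset_le) (use that \<open>T \<le> t\<close> C in auto)
    ultimately show ?thesis by (simp add: K_def)
  qed
  have "continuous (at T within {0..t}) ?w"
    using contw T(1) by (simp add: continuous_on_eq_continuous_within)
  then have "(?w \<longlongrightarrow> 0) (at T within {0..t})"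
    using T(1) by (simp add: continuous_within)
  then have "(?w \<longlongrightarrow> 0) (at T within {0..T})"
    by (rule tendsto_within_subset) (use \<open>T \<le> t\<close> in auto)
  then have "((\<lambda>s. norm (?w s)) \<longlongrightarrow> 0) (at_left T)"
    using \<open>0 < T\<close> by (simp add: at_within_Icc_at_left tendsto_norm_zero)
  moreover have ev: "eventually (\<lambda>s. 0 < s \<and> s < T) (at_left T)"
    using eventually_at_left_real[OF \<open>0 < T\<close>] by simp
  then have "eventually (\<lambda>s. norm (?w s) \<in> {0<..} \<and> norm (?w s) \<noteq> 0) (at_left T)"
    by eventually_elim (use ne in auto)
  ultimately have "filterlim (\<lambda>s. norm (?w s)) (at_right 0) (at_left T)"
    by (simp add: filterlim_at)
  moreover have "filterlim (osgood_M L) at_top (at_right 0)"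
    using L by (simp add: osgood_modulus_def)
  ultimately have "filterlim (\<lambda>s. osgood_M L (norm (?w s))) at_top (at_left T)"
    using filterlim_compose by blast
  then have "eventually (\<lambda>s. K < osgood_M L (norm (?w s))) (at_left T)"
    by (simp add: filterlim_at_top_dense)
  with ev have "eventually (\<lambda>s. False) (at_left T)"
    by eventually_elim (use le in force)
  then show False by simp
qed

lemma flow_M_bounded_distortion:
  fixes u :: "'a::euclidean_space \<Rightarrow> real \<Rightarrow> 'a"
  assumes L: "osgood_modulus L" and flow: "is_flow u \<phi>"
    and cont: "continuous_on (UNIV \<times> {0..}) (\<lambda>(x, t). u x t)"
    and u: "has_modulus_of_continuity u L" and "0 \<le> t"
  shows "M_bounded_distortion L (\<lambda>x. \<phi> x t)"
proof -
  obtain C where C: "\<And>t. 0 \<le> t \<Longrightarrow> 0 \<le> C t" "\<And>T. 0 < T \<Longrightarrow> C absolutely_integrable_on {0<..<T}"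
      "\<And>t x y. 0 \<le> t \<Longrightarrow> 0 < norm (x - y) \<Longrightarrow> norm (x - y) < 1 \<Longrightarrow>
         norm (u x t - u y t) \<le> C t * L (norm (x - y))"
    using u unfolding has_modulus_of_continuity_def by blast
  have int: "C integrable_on {0..T}" for T
  proof (cases "0 < T")
    case True
    then show ?thesis
      using C(2) integrable_on_Icc_iff_Ioo set_lebesgue_integral_eq_integral(1) by blast
  next
    case False
    then show ?thesis using integrable_on_refl[of C 0] by (cases "T = 0") auto
  qed
  have ne: "\<phi> x s \<noteq> \<phi> y s" if "0 \<le> s" "x \<noteq> y" for x y s
    by (rule flow_separates[OF L flow cont C(1) int C(3) that])
  have "\<bar>osgood_M L (norm (\<phi> x t - \<phi> y t)) - osgood_M L (norm (x - y))\<bar> \<le> integral {0..t} C"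
    if "x \<noteq> y" for x y
    by (rule flow_M_bound[OF L flow cont C(1) int C(3) \<open>0 \<le> t\<close>]) (use ne that in auto)
  moreover have "inj (\<lambda>x. \<phi> x t)"
    using ne \<open>0 \<le> t\<close> by (meson injI)
  ultimately show ?thesis unfolding M_bounded_distortion_def by blast
qed

section \<open>Invariance of the seminorms\<close>

text \<open>The global and the local seminorm differ only in the set of admissible pairs of points.
  With that set as a parameter \<open>P\<close>, both claims of the theorem become one: the flow maps the
  pairs over \<open>x\<close> to the pairs over \<open>\<phi>(x, t)\<close>, and all pairs to all pairs.\<close>

definition pair_seminorm ::
    "(real \<Rightarrow> real) \<Rightarrow> real \<Rightarrow> ('a::real_normed_vector \<times> 'a) set \<Rightarrow> ('a \<Rightarrow> real) \<Rightarrow> ennreal" where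
  "pair_seminorm L \<gamma> P f =
     Lim (at_right 0) (\<lambda>r. SUP (x, y)\<in>{(x, y) \<in> P. 0 < norm (x - y) \<and> norm (x - y) < r}.
       ennreal (\<bar>f x - f y\<bar> / osgood_M L (norm (x - y)) powr \<gamma>))"

lemma seminorm_L_eq_pair_seminorm: "seminorm_L L \<gamma> f = pair_seminorm L \<gamma> UNIV f"
  by (simp add: seminorm_L_def pair_seminorm_def)

lemma local_seminorm_L_eq_pair_seminorm:
  "local_seminorm_L L \<gamma> x f = pair_seminorm L \<gamma> ({x} \<times> UNIV) f"
proof -
  have "{(a, y) \<in> {x} \<times> UNIV. 0 < norm (a - y) \<and> norm (a - y) < r}
      = Pair x ` {y. 0 < norm (x - y) \<and> norm (x - y) < r}" for r
    by auto
  then show ?thesis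
    by (simp add: local_seminorm_L_def pair_seminorm_def image_comp o_def)
qed

lemma pair_seminorm_tendsto:
  "((\<lambda>r. SUP (x, y)\<in>{(x, y) \<in> P. 0 < norm (x - y) \<and> norm (x - y) < r}.
       ennreal (\<bar>f x - f y\<bar> / osgood_M L (norm (x - y)) powr \<gamma>)) \<longlongrightarrow> pair_seminorm L \<gamma> P f)
     (at_right 0)"
  unfolding pair_seminorm_def
  by (rule mono_tendsto_Lim_at_right, rule monoI, rule SUP_subset_mono) auto

text \<open>Numbers at distance at most \<open>B\<close> have a quotient close to 1 once they are large, and
  \<open>s \<mapsto> s powr \<gamma>\<close> is continuous at 1. This holds for either sign of \<open>\<gamma>\<close>.\<close>

lemma powr_ratio_near_one:
  fixes B K \<gamma> :: real
  assumes "1 < K"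
  obtains R where "\<And>a b. R \<le> a \<Longrightarrow> R \<le> b \<Longrightarrow> \<bar>a - b\<bar> \<le> B \<Longrightarrow> 0 < b \<and> a powr \<gamma> \<le> K * b powr \<gamma>"
proof -
  have "((\<lambda>s::real. s powr \<gamma>) \<longlongrightarrow> 1 powr \<gamma>) (nhds 1)"
    by (intro tendsto_intros) (auto simp: filterlim_ident)
  then have "eventually (\<lambda>s. s powr \<gamma> < K) (nhds 1)"
    using assms by (auto dest: order_tendstoD(2))
  then obtain e where e: "0 < e" "\<And>s. \<bar>s - 1\<bar> < e \<Longrightarrow> s powr \<gamma> < K"
    by (auto simp: eventually_nhds_metric dist_real_def)
  define R where "R = \<bar>B\<bar> / e + 1"
  have "0 < R" unfolding R_def using e(1) by (intro add_nonneg_pos) auto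
  have "0 < b \<and> a powr \<gamma> \<le> K * b powr \<gamma>" if "R \<le> a" "R \<le> b" "\<bar>a - b\<bar> \<le> B" for a b
  proof -
    have pos: "0 < a" "0 < b" using that \<open>0 < R\<close> by auto
    have "\<bar>B\<bar> < e * R" using e(1) by (simp add: R_def distrib_left)
    also have "\<dots> \<le> e * b" using that e(1) by simp
    finally have "\<bar>a - b\<bar> < e * b" using that by linarith
    moreover have "a / b - 1 = (a - b) / b" using pos by (simp add: diff_divide_distrib)
    ultimately have "\<bar>a / b - 1\<bar> < e" using pos by (simp add: pos_divide_less_eq)
    then have "(a / b) powr \<gamma> < K" by (rule e(2))
    then have "a powr \<gamma> < K * b powr \<gamma>" using pos by (simp add: powr_divide pos_divide_less_eq)
    then show ?thesis using pos by simp
  qed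
  then show ?thesis using that by blast
qed

text \<open>The only delicate value is \<open>b = \<infinity>\<close>, where the conclusion is trivial; for finite \<open>b\<close> let
  \<open>K\<close> decrease to 1.\<close>

lemma ennreal_le_of_le_mult:
  fixes a b :: ennreal
  assumes "\<And>K::real. 1 < K \<Longrightarrow> a \<le> ennreal K * b"
  shows "a \<le> b"
proof (cases "b = top")
  case False
  have "((\<lambda>K. ennreal K * b) \<longlongrightarrow> ennreal 1 * b) (at_right 1)"
    using False by (intro tendsto_mult_ennreal tendsto_intros) (auto simp: filterlim_ident intro: tendsto_ident_at)
  moreover have "eventually (\<lambda>K. a \<le> ennreal K * b) (at_right (1::real))"
    using assms by (auto simp: eventually_at_right_field intro: exI[of _ 2])
  ultimately have "a \<le> ennreal 1 * b"
    by (intro tendsto_lowerbound) auto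
  then show ?thesis by simp
qed simp

text \<open>For \<open>K > 1\<close> and close points, the difference quotient of \<open>f \<circ> h\<close> at \<open>(x, y)\<close> is at most
  \<open>K\<close> times that of \<open>f\<close> at \<open>(h x, h y)\<close>, and \<open>h\<close> maps close pairs to close pairs. Letting
  both radii tend to 0, and then \<open>K\<close> to 1, gives the claim.\<close>

lemma pair_seminorm_comp_le:
  assumes L: "osgood_modulus L" and h: "M_bounded_distortion L h" and PQ: "map_prod h h ` P \<subseteq> Q"
  shows "pair_seminorm L \<gamma> P (f \<circ> h) \<le> pair_seminorm L \<gamma> Q f"
proof (rule ennreal_le_of_le_mult)
  fix K :: real assume "1 < K"
  define q where "q f x y = \<bar>f x - f y\<bar> / osgood_M L (norm (x - y)) powr \<gamma>" for f and x y :: 'a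
  define S where "S P f r = (SUP (x, y)\<in>{(x, y) \<in> P. 0 < norm (x - y) \<and> norm (x - y) < r}. ennreal (q f x y))"
    for P f r
  have lim: "(S P f \<longlongrightarrow> pair_seminorm L \<gamma> P f) (at_right 0)" for P f
    using pair_seminorm_tendsto[where P = P and f = f and L = L and \<gamma> = \<gamma>] by (simp add: S_def[abs_def] q_def)
  from h obtain B where inj: "inj h" and
    B: "\<And>x y. x \<noteq> y \<Longrightarrow> \<bar>osgood_M L (norm (h x - h y)) - osgood_M L (norm (x - y))\<bar> \<le> B"
    unfolding M_bounded_distortion_def by blast
  obtain R where R: "\<And>a b. R \<le> a \<Longrightarrow> R \<le> b \<Longrightarrow> \<bar>a - b\<bar> \<le> B \<Longrightarrow> 0 < b \<and> a powr \<gamma> \<le> K * b powr \<gamma>"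
    using powr_ratio_near_one[OF \<open>1 < K\<close>] by blast
  have "filterlim (osgood_M L) at_top (at_right 0)"
    using L by (simp add: osgood_modulus_def)
  \<comment> \<open>The margin \<open>|B|\<close> ensures that \<open>\<M>\<close> of the image distance is also at least \<open>R\<close>.\<close>
  then have "eventually (\<lambda>z. R + \<bar>B\<bar> \<le> osgood_M L z) (at_right 0)"
    by (simp add: filterlim_at_top)
  then obtain d where d: "0 < d" "\<And>z. 0 < z \<Longrightarrow> z < d \<Longrightarrow> R + \<bar>B\<bar> \<le> osgood_M L z"
    by (auto simp: eventually_at_right_field)
  have q_le: "q (f \<circ> h) x y \<le> K * q f (h x) (h y)" if "x \<noteq> y" "norm (x - y) < d" for x y
  proof -
    let ?a = "osgood_M L (norm (h x - h y))" and ?b = "osgood_M L (norm (x - y))"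
    have "R + \<bar>B\<bar> \<le> ?b" using d(2)[of "norm (x - y)"] that by simp
    then have "R \<le> ?a" "R \<le> ?b" using B[OF that(1)] by linarith+
    then have "0 < ?a" and "0 < ?b" "?a powr \<gamma> \<le> K * ?b powr \<gamma>"
      using R[of ?a ?b] R[of ?b ?a] B[OF that(1)] by (auto simp: abs_minus_commute)
    have "1 / ?b powr \<gamma> \<le> K / ?a powr \<gamma>"
      using \<open>0 < ?a\<close> \<open>0 < ?b\<close> \<open>?a powr \<gamma> \<le> K * ?b powr \<gamma>\<close> by (simp add: field_simps)
    from mult_left_mono[OF this, of "\<bar>f (h x) - f (h y)\<bar>"] show ?thesis
      by (simp add: q_def field_simps)
  qed
  have main: "pair_seminorm L \<gamma> P (f \<circ> h) \<le> ennreal K * S Q f r" if "0 < r" for r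
  proof -
    obtain e where e: "0 < e" "\<And>x y. norm (x - y) < e \<Longrightarrow> norm (h x - h y) < r"
      using M_bounded_distortion_uniform[OF L h \<open>0 < r\<close>] by blast
    have *: "S P (f \<circ> h) s \<le> ennreal K * S Q f r" if s: "s < min d e" for s
      unfolding S_def[of P]
    proof (rule SUP_least, clarify)
      fix x y assume xy: "(x, y) \<in> P" "0 < norm (x - y)" "norm (x - y) < s"
      then have "x \<noteq> y" by auto
      then have "h x \<noteq> h y" using inj by (auto dest: injD)
      have "ennreal (q (f \<circ> h) x y) \<le> ennreal (K * q f (h x) (h y))"
        using q_le[OF \<open>x \<noteq> y\<close>] xy s by (intro ennreal_leI) auto
      also have "\<dots> = ennreal K * ennreal (q f (h x) (h y))"
        using \<open>1 < K\<close> by (intro ennreal_mult) (auto simp: q_def)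
      also have "ennreal (q f (h x) (h y)) \<le> S Q f r"
        unfolding S_def
        by (rule SUP_upper2[of "(h x, h y)"]) (use PQ xy s e \<open>h x \<noteq> h y\<close> in auto)
      finally show "ennreal (q (f \<circ> h) x y) \<le> ennreal K * S Q f r"
        by (simp add: mult_left_mono)
    qed
    have "eventually (\<lambda>s. S P (f \<circ> h) s \<le> ennreal K * S Q f r) (at_right 0)"
      using * d(1) e(1) by (auto simp: eventually_at_right_field intro!: exI[of _ "min d e"])
    then show ?thesis
      by (intro tendsto_upperbound[OF lim]) auto
  qed
  have "((\<lambda>r. ennreal K * S Q f r) \<longlongrightarrow> ennreal K * pair_seminorm L \<gamma> Q f) (at_right 0)"
    by (intro ennreal_tendsto_cmult lim) simp
  moreover have "eventually (\<lambda>r. pair_seminorm L \<gamma> P (f \<circ> h) \<le> ennreal K * S Q f r) (at_right 0)"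
    using main by (auto simp: eventually_at_right_field intro: exI[of _ 1])
  ultimately show "pair_seminorm L \<gamma> P (f \<circ> h) \<le> ennreal K * pair_seminorm L \<gamma> Q f"
    by (intro tendsto_lowerbound) auto
qed

text \<open>Both \<open>h\<close> and its inverse have bounded distortion, so the preceding inequality applies in
  both directions.\<close>

lemma pair_seminorm_comp_eq:
  assumes L: "osgood_modulus L" and h: "M_bounded_distortion L h" "surj h"
  shows "pair_seminorm L \<gamma> P (f \<circ> h) = pair_seminorm L \<gamma> (map_prod h h ` P) f"
proof (rule antisym)
  show "pair_seminorm L \<gamma> P (f \<circ> h) \<le> pair_seminorm L \<gamma> (map_prod h h ` P) f"
    by (rule pair_seminorm_comp_le[OF L h(1)]) simp
  have "inj h" using h(1) by (simp add: M_bounded_distortion_def)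
  then have "map_prod (inv h) (inv h) ` map_prod h h ` P \<subseteq> P"
    by auto
  then have "pair_seminorm L \<gamma> (map_prod h h ` P) ((f \<circ> h) \<circ> inv h) \<le> pair_seminorm L \<gamma> P (f \<circ> h)"
    by (rule pair_seminorm_comp_le[OF L M_bounded_distortion_inv[OF h]])
  moreover have "(f \<circ> h) \<circ> inv h = f"
    by (rule ext) (simp add: surj_f_inv_f[OF h(2)])
  ultimately show "pair_seminorm L \<gamma> (map_prod h h ` P) f \<le> pair_seminorm L \<gamma> P (f \<circ> h)"
    by metis
qed

theorem theorem1:
  fixes L :: "real \<Rightarrow> real"
    and u :: "real ^ 'n \<Rightarrow> real \<Rightarrow> real ^ 'n"
    and \<phi> :: "real ^ 'n \<Rightarrow> real \<Rightarrow> real ^ 'n"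
    and \<theta>0 :: "real ^ 'n \<Rightarrow> real"
    and \<theta> :: "real \<Rightarrow> real ^ 'n \<Rightarrow> real"
  assumes "osgood_modulus L"
    and "bounded ((\<lambda>(x, t). u x t) ` (UNIV \<times> {0..}))"
    and "continuous_on (UNIV \<times> {0..}) (\<lambda>(x, t). u x t)"
    and "incompressible u"
    and "has_modulus_of_continuity u L"
    and "is_flow u \<phi>"
    and "\<And>t. t \<ge> 0 \<Longrightarrow> \<theta> t = lagrangian_solution \<phi> \<theta>0 t"
  shows "\<forall>\<gamma>. \<forall>t\<ge>0.
           seminorm_L L \<gamma> (\<theta> t) = seminorm_L L \<gamma> \<theta>0 \<and>
           (\<forall>x. local_seminorm_L L \<gamma> (\<phi> x t) (\<theta> t) = local_seminorm_L L \<gamma> x \<theta>0)"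
proof (intro allI impI)
  fix \<gamma> t :: real assume "0 \<le> t"
  define h where "h = (\<lambda>x. \<phi> x t)"
  have h: "M_bounded_distortion L h"
    unfolding h_def by (rule flow_M_bounded_distortion[OF assms(1,6,3,5) \<open>0 \<le> t\<close>])
  obtain K where "\<And>x t. 0 \<le> t \<Longrightarrow> norm (u x t) \<le> K"
    using assms(2) by (force simp: bounded_iff)
  then have "norm (h x - x) \<le> K * t" for x
    unfolding h_def by (rule flow_displacement[OF assms(6) _ \<open>0 \<le> t\<close>])
  then have "surj h"
    by (rule bounded_displacement_surj[OF M_bounded_distortion_continuous[OF assms(1) h]])
  have "inj h" using h by (simp add: M_bounded_distortion_def)
  have "\<theta> t \<circ> h = \<theta>0"
  proof
    fix x
    have "\<theta> t = (\<lambda>y. \<theta>0 (inv h y))"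
      unfolding assms(7)[OF \<open>0 \<le> t\<close>] h_def by (rule ext) (rule lagrangian_solution_def)
    then show "(\<theta> t \<circ> h) x = \<theta>0 x"
      using inv_f_f[OF \<open>inj h\<close>] by simp
  qed
  then have eq: "pair_seminorm L \<gamma> P \<theta>0 = pair_seminorm L \<gamma> (map_prod h h ` P) (\<theta> t)" for P
    using pair_seminorm_comp_eq[OF assms(1) h \<open>surj h\<close>, of \<gamma> P "\<theta> t"] by simp
  have "map_prod h h ` UNIV = UNIV"
    using map_prod_surj_on[of h UNIV UNIV h UNIV UNIV] \<open>surj h\<close> by simp
  moreover have "map_prod h h ` ({x} \<times> UNIV) = {h x} \<times> UNIV" for x
    using map_prod_surj_on[of h "{x}" "{h x}" h UNIV UNIV] \<open>surj h\<close> by simp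
  ultimately show "seminorm_L L \<gamma> (\<theta> t) = seminorm_L L \<gamma> \<theta>0 \<and>
      (\<forall>x. local_seminorm_L L \<gamma> (\<phi> x t) (\<theta> t) = local_seminorm_L L \<gamma> x \<theta>0)"
    unfolding seminorm_L_eq_pair_seminorm local_seminorm_L_eq_pair_seminorm eq
    by (simp add: h_def)
qed

end
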